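(* Let $\kappa>\omega$ be a cardinal and let $F_\kappa=\langle e_i : i<\kappa\rangle$ be the free group with basis $\{e_i : i<\kappa\}$. Then $F_\kappa$, as a first-order structure in the language of groups, is not $\aleph_1$-homogeneous.
   Context: A structure $M$ is $\aleph_1$-homogeneous if for every subset $A\subseteq M$ with $|A|<\aleph_1$, every partial elementary map $f:A\to M$ and every $a\in M$, there is $b\in M$ such that $f\cup\{(a,b)\}$ is a partial elementary map. Equivalently: whenever $\bar{c},\bar{d}$ are countable (possibly infinite) tuples in $M$ with $tp^M(\bar{c})=tp^M(\bar{d})$ and $a\in M$, there is $b\in M$ with $tp^M(a,\bar{c})=tp^M(b,\bar{d})$. *)

theory Defs
  imports "HOL-Algebra.Generated_Groups" "HOL-Library.Countable_Set"
begin

unbundle cardinal_syntax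

section \<open>First-order logic in the language of groups\<close>

datatype group_term =
    Var nat
  | One
  | Inv group_term
  | Mult group_term group_term

text \<open>The remaining connectives and the universal quantifier are definable from these.\<close>

datatype group_formula =
    Eq group_term group_term
  | Neg group_formula
  | Conj group_formula group_formula
  | Ex nat group_formula

primrec vars_term :: "group_term \<Rightarrow> nat set" where
  "vars_term (Var n) = {n}"
| "vars_term One = {}"
| "vars_term (Inv t) = vars_term t"
| "vars_term (Mult s t) = vars_term s \<union> vars_term t"

primrec free_vars :: "group_formula \<Rightarrow> nat set" where
  "free_vars (Eq s t) = vars_term s \<union> vars_term t"
| "free_vars (Neg \<phi>) = free_vars \<phi>"
| "free_vars (Conj \<phi> \<psi>) = free_vars \<phi> \<union> free_vars \<psi>"
| "free_vars (Ex n \<phi>) = free_vars \<phi> - {n}"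

primrec eval_term :: "('a, 'b) monoid_scheme \<Rightarrow> (nat \<Rightarrow> 'a) \<Rightarrow> group_term \<Rightarrow> 'a" where
  "eval_term G v (Var n) = v n"
| "eval_term G v One = \<one>\<^bsub>G\<^esub>"
| "eval_term G v (Inv t) = inv\<^bsub>G\<^esub> (eval_term G v t)"
| "eval_term G v (Mult s t) = eval_term G v s \<otimes>\<^bsub>G\<^esub> eval_term G v t"

primrec sat :: "('a, 'b) monoid_scheme \<Rightarrow> (nat \<Rightarrow> 'a) \<Rightarrow> group_formula \<Rightarrow> bool" where
  "sat G v (Eq s t) \<longleftrightarrow> eval_term G v s = eval_term G v t"
| "sat G v (Neg \<phi>) \<longleftrightarrow> \<not> sat G v \<phi>"
| "sat G v (Conj \<phi> \<psi>) \<longleftrightarrow> sat G v \<phi> \<and> sat G v \<psi>"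
| "sat G v (Ex n \<phi>) \<longleftrightarrow> (\<exists>a\<in>carrier G. sat G (v(n := a)) \<phi>)"


section \<open>Partial elementary maps and homogeneity\<close>

text \<open>
  A partial map is given by its graph, so that extending it by one point is insertion of a pair.
  The valuations \<open>v\<close> and \<open>w\<close> range over the finite tuples from the domain and their images under
  \<open>f\<close>; their values at variables that are not free in \<open>\<phi>\<close> are irrelevant.
\<close>

definition partial_elementary_map ::
    "('a, 'b) monoid_scheme \<Rightarrow> ('a \<times> 'a) set \<Rightarrow> bool" where
  "partial_elementary_map G f \<longleftrightarrow>
     f \<subseteq> carrier G \<times> carrier G \<and> single_valued f \<and>
     (\<forall>\<phi> v w. v \<in> UNIV \<rightarrow> carrier G \<longrightarrow> w \<in> UNIV \<rightarrow> carrier G \<longrightarrow>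
        (\<forall>n\<in>free_vars \<phi>. (v n, w n) \<in> f) \<longrightarrow> (sat G v \<phi> \<longleftrightarrow> sat G w \<phi>))"

definition aleph1_homogeneous :: "('a, 'b) monoid_scheme \<Rightarrow> bool" where
  "aleph1_homogeneous G \<longleftrightarrow>
     (\<forall>A f. A \<subseteq> carrier G \<longrightarrow> countable A \<longrightarrow> Domain f = A \<longrightarrow> partial_elementary_map G f \<longrightarrow>
        (\<forall>a\<in>carrier G. \<exists>b\<in>carrier G. partial_elementary_map G (f \<union> {(a, b)})))"


section \<open>Free groups\<close>

text \<open>A letter \<open>(i, True)\<close> stands for \<open>e\<^sub>i\<close> and \<open>(i, False)\<close> for its inverse.\<close>

type_synonym 'i letter = "'i \<times> bool"

definition inv_letter :: "'i letter \<Rightarrow> 'i letter" where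
  "inv_letter x = (fst x, \<not> snd x)"

definition reduced :: "'i letter list \<Rightarrow> bool" where
  "reduced w \<longleftrightarrow> successively (\<lambda>x y. y \<noteq> inv_letter x) w"

fun push_letter :: "'i letter \<Rightarrow> 'i letter list \<Rightarrow> 'i letter list" where
  "push_letter x [] = [x]"
| "push_letter x (y # w) = (if y = inv_letter x then w else x # y # w)"

definition reduce_word :: "'i letter list \<Rightarrow> 'i letter list" where
  "reduce_word w = foldr push_letter w []"

definition free_group :: "'i set \<Rightarrow> 'i letter list monoid" where
  "free_group I =
     \<lparr>carrier = {w. reduced w \<and> fst ` set w \<subseteq> I},
      mult = (\<lambda>u v. reduce_word (u @ v)),
      one = []\<rparr>"

definition free_basis :: "'i \<Rightarrow> 'i letter list" where
  "free_basis i = [(i, True)]"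


subsection \<open>It is a group, free on the basis\<close>

lemma inv_letter_invol [simp]: "inv_letter (inv_letter x) = x"
  by (simp add: inv_letter_def)

lemma fst_inv_letter [simp]: "fst (inv_letter x) = fst x"
  by (simp add: inv_letter_def)

lemma reduced_Nil [simp]: "reduced []"
  by (simp add: reduced_def)

lemma reduced_tl: "reduced (x # w) \<Longrightarrow> reduced w"
  by (cases w) (auto simp: reduced_def)

lemma reduced_push: "reduced w \<Longrightarrow> reduced (push_letter x w)"
  by (cases w) (auto simp: reduced_def successively_Cons)

lemma push_reduced: "reduced (x # w) \<Longrightarrow> push_letter x w = x # w"
  by (cases w) (auto simp: reduced_def)

lemma push_push_inv: "reduced w \<Longrightarrow> push_letter x (push_letter (inv_letter x) w) = w"
  by (cases w) (auto simp: push_reduced)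

lemma set_push: "set (push_letter x w) \<subseteq> insert x (set w)"
  by (cases w) auto

lemma reduced_foldr: "reduced w \<Longrightarrow> reduced (foldr push_letter u w)"
  by (induction u) (auto simp: reduced_push)

lemma set_foldr: "set (foldr push_letter u w) \<subseteq> set u \<union> set w"
proof (induction u)
  case (Cons x u)
  have "set (foldr push_letter (x # u) w) \<subseteq> insert x (set (foldr push_letter u w))"
    using set_push by simp
  also have "\<dots> \<subseteq> set (x # u) \<union> set w"
    using Cons by auto
  finally show ?case .
qed simp

lemma fst_set_foldr:
  "fst ` set u \<subseteq> I \<Longrightarrow> fst ` set w \<subseteq> I \<Longrightarrow> fst ` set (foldr push_letter u w) \<subseteq> I"
  using image_mono[OF set_foldr[of u w], of fst] unfolding image_Un
  by (rule order_trans) (rule Un_least)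

lemma reduce_reduced: "reduced w \<Longrightarrow> foldr push_letter w [] = w"
proof (induction w)
  case (Cons x w)
  then show ?case using reduced_tl[OF Cons.prems] by (simp add: push_reduced)
qed simp

lemma foldr_push:
  "reduced w \<Longrightarrow> foldr push_letter (push_letter x v) w = push_letter x (foldr push_letter v w)"
  by (cases v) (auto simp: push_push_inv reduced_foldr)

lemma foldr_foldr:
  "reduced w \<Longrightarrow>
     foldr push_letter (foldr push_letter u v) w = foldr push_letter u (foldr push_letter v w)"
  by (induction u) (auto simp: foldr_push)

lemma carrier_free_group:
  "w \<in> carrier (free_group I) \<longleftrightarrow> reduced w \<and> fst ` set w \<subseteq> I"
  by (simp add: free_group_def)

lemma one_free_group: "\<one>\<^bsub>free_group I\<^esub> = []"
  by (simp add: free_group_def)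

lemma mult_free_group:
  "reduced v \<Longrightarrow> u \<otimes>\<^bsub>free_group I\<^esub> v = foldr push_letter u v"
  by (simp add: free_group_def reduce_word_def reduce_reduced)

lemma foldr_push_inv:
  "reduced w \<Longrightarrow> foldr push_letter (rev (map inv_letter u)) (foldr push_letter u w) = w"
proof (induction u)
  case (Cons x u)
  then show ?case
    using push_push_inv[OF reduced_foldr, of w "inv_letter x" u] by simp
qed simp

lemma group_free_group: "group (free_group I)"
proof (rule groupI)
  fix x y assume "x \<in> carrier (free_group I)" "y \<in> carrier (free_group I)"
  then show "x \<otimes>\<^bsub>free_group I\<^esub> y \<in> carrier (free_group I)"
    by (simp add: carrier_free_group mult_free_group reduced_foldr fst_set_foldr)
next
  fix x assume x: "x \<in> carrier (free_group I)"
  let ?y = "foldr push_letter (rev (map inv_letter x)) []"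
  have "?y \<in> carrier (free_group I)"
    using x by (simp add: carrier_free_group reduced_foldr fst_set_foldr image_image)
  moreover have "?y \<otimes>\<^bsub>free_group I\<^esub> x = \<one>\<^bsub>free_group I\<^esub>"
    using x foldr_push_inv[of "[]" x]
    by (simp add: carrier_free_group mult_free_group one_free_group foldr_foldr reduce_reduced)
  ultimately show "\<exists>y\<in>carrier (free_group I). y \<otimes>\<^bsub>free_group I\<^esub> x = \<one>\<^bsub>free_group I\<^esub>"
    by blast
qed (auto simp: carrier_free_group mult_free_group one_free_group foldr_foldr reduced_foldr)

lemma free_basis_carrier: "free_basis i \<in> carrier (free_group I) \<longleftrightarrow> i \<in> I"
  by (simp add: carrier_free_group free_basis_def reduced_def)

lemma inv_free_basis: "i \<in> I \<Longrightarrow> inv\<^bsub>free_group I\<^esub> (free_basis i) = [(i, False)]"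
  by (rule group.inv_equality[OF group_free_group])
     (auto simp: mult_free_group one_free_group carrier_free_group free_basis_def reduced_def
       inv_letter_def)

lemma generate_free_basis: "generate (free_group I) (free_basis ` I) = carrier (free_group I)"
proof
  show "generate (free_group I) (free_basis ` I) \<subseteq> carrier (free_group I)"
    by (rule group.generate_incl[OF group_free_group]) (auto simp: free_basis_carrier)
next
  have "w \<in> generate (free_group I) (free_basis ` I)" if "w \<in> carrier (free_group I)" for w
    using that
  proof (induction w)
    case Nil
    then show ?case using generate.one[of "free_group I"] by (simp add: one_free_group)
  next
    case (Cons x w)
    obtain i b where x: "x = (i, b)" by (cases x)
    have i: "i \<in> I" and red: "reduced (x # w)" and w: "w \<in> carrier (free_group I)"
      using Cons.prems x by (auto simp: carrier_free_group dest: reduced_tl)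
    have "[x] \<in> generate (free_group I) (free_basis ` I)"
    proof (cases b)
      case True
      then show ?thesis using generate.incl[of "free_basis i" "free_basis ` I" "free_group I"] i x
        by (simp add: free_basis_def)
    next
      case False
      then show ?thesis using generate.inv[of "free_basis i" "free_basis ` I" "free_group I"] i x
        by (simp add: inv_free_basis)
    qed
    moreover have "[x] \<otimes>\<^bsub>free_group I\<^esub> w = x # w"
      using red w by (simp add: mult_free_group carrier_free_group push_reduced)
    ultimately show ?case using generate.eng[of "[x]" _ _ w] Cons.IH[OF w] by force
  qed
  then show "carrier (free_group I) \<subseteq> generate (free_group I) (free_basis ` I)" by blast
qed

lemma free_group_extend:
  assumes "group H" and f: "f \<in> I \<rightarrow> carrier H"
  shows "\<exists>h\<in>hom (free_group I) H. \<forall>i\<in>I. h (free_basis i) = f i"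
proof -
  interpret H: group H by fact
  define l where "l = (\<lambda>x. if snd x then f (fst x) else inv\<^bsub>H\<^esub> f (fst x))"
  define h where "h = (\<lambda>w. foldr (\<lambda>x y. l x \<otimes>\<^bsub>H\<^esub> y) w \<one>\<^bsub>H\<^esub>)"
  have l: "l x \<in> carrier H" if "fst x \<in> I" for x
    using f that by (auto simp: l_def)
  have l_inv: "l (inv_letter x) = inv\<^bsub>H\<^esub> l x" if "fst x \<in> I" for x
    using f that by (auto simp: l_def inv_letter_def Pi_iff)
  have hc: "h w \<in> carrier H" if "fst ` set w \<subseteq> I" for w
    using that by (induction w) (auto simp: h_def l)
  have h_push: "h (push_letter x w) = l x \<otimes>\<^bsub>H\<^esub> h w"
    if "fst x \<in> I" "fst ` set w \<subseteq> I" for x w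
  proof (cases w)
    case (Cons y v)
    have v: "h v \<in> carrier H" using that Cons hc by simp
    show ?thesis
    proof (cases "y = inv_letter x")
      case True
      then have "l x \<otimes>\<^bsub>H\<^esub> h w = l x \<otimes>\<^bsub>H\<^esub> (inv\<^bsub>H\<^esub> l x \<otimes>\<^bsub>H\<^esub> h v)"
        using Cons that by (simp add: h_def l_inv)
      also have "\<dots> = h v" using v l[OF that(1)] by (simp add: H.m_assoc[symmetric])
      finally show ?thesis using True Cons by simp
    qed (simp add: Cons h_def)
  qed (simp add: h_def)
  have h_foldr: "h (foldr push_letter u v) = h u \<otimes>\<^bsub>H\<^esub> h v"
    if "fst ` set u \<subseteq> I" "fst ` set v \<subseteq> I" for u v
    using that
  proof (induction u)
    case (Cons x u)
    have "fst ` set (foldr push_letter u v) \<subseteq> I"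
      using Cons.prems by (simp add: fst_set_foldr)
    then have "h (foldr push_letter (x # u) v) = l x \<otimes>\<^bsub>H\<^esub> (h u \<otimes>\<^bsub>H\<^esub> h v)"
      using Cons by (simp add: h_push)
    then show ?case using Cons.prems hc[of u] hc[of v] l[of x]
      by (simp add: h_def H.m_assoc)
  qed (use hc in \<open>simp add: h_def\<close>)
  have "h \<in> hom (free_group I) H"
    by (rule homI) (auto simp: carrier_free_group mult_free_group h_foldr hc)
  moreover have "h (free_basis i) = f i" if "i \<in> I" for i
    using f that by (simp add: h_def free_basis_def l_def Pi_iff)
  ultimately show ?thesis by blast
qed

end

theory Submission
  imports Defs
begin

text \<open>
  Let \<open>e\<^sub>0, e\<^sub>1, \<dots>\<close> be distinct elements of the basis and put \<open>d\<^sub>n = e\<^sub>n e\<^sub>n\<^sub>+\<^sub>1\<^sup>-\<^sup>2\<close>. Any finite initial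
  segment \<open>d\<^sub>0, \<dots>, d\<^sub>n\<close> can be completed to a basis by the remaining original basis elements, so an
  automorphism carries it to \<open>e\<^sub>0, \<dots>, e\<^sub>n\<close> (\<open>straightening_automorphism\<close>). A formula mentions only
  finitely many elements, hence the whole map \<open>d\<^sub>n \<mapsto> e\<^sub>n\<close> is partial elementary, even though
  it is not induced by an automorphism.

  In fact it cannot be extended to \<open>e\<^sub>0\<close>. Unfolding \<open>e\<^sub>n = d\<^sub>n e\<^sub>n\<^sub>+\<^sub>1\<^sup>2\<close> repeatedly gives, for every \<open>k\<close>,
  \<open>e\<^sub>0 = d\<^sub>0 (d\<^sub>1 (\<dots> (d\<^sub>k y\<^sup>2)\<^sup>2 \<dots>)\<^sup>2)\<^sup>2\<close> with \<open>y = e\<^sub>k\<^sub>+\<^sub>1\<close>. The existence of such a \<open>y\<close> is expressed by a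
  formula, so an image \<open>b\<close> of \<open>e\<^sub>0\<close> would satisfy \<open>b = e\<^sub>0 (e\<^sub>1 (\<dots> (e\<^sub>k y\<^sub>k\<^sup>2)\<^sup>2 \<dots>)\<^sup>2)\<^sup>2\<close> for every \<open>k\<close>, with
  some \<open>y\<^sub>k\<close> depending on \<open>k\<close>. Counting the exponents of \<open>e\<^sub>k\<close> shows that the exponent sum of \<open>e\<^sub>k\<close> in
  \<open>b\<close> is \<open>2\<^sup>k\<close> times an odd number, so that \<open>b\<close> involves every \<open>e\<^sub>k\<close>. But \<open>b\<close> is a finite word.
\<close>

section \<open>Automorphisms and partial elementary maps\<close>

lemma finite_vars_term: "finite (vars_term t)"
  by (induction t) auto

lemma finite_free_vars: "finite (free_vars \<phi>)"
  by (induction \<phi>) (auto simp: finite_vars_term)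

lemma eval_term_closed:
  assumes "group G" "v \<in> UNIV \<rightarrow> carrier G"
  shows "eval_term G v t \<in> carrier G"
proof -
  interpret group G by fact
  show ?thesis using assms(2) by (induction t) auto
qed

lemma eval_term_cong:
  "(\<And>n. n \<in> vars_term t \<Longrightarrow> v n = w n) \<Longrightarrow> eval_term G v t = eval_term G w t"
  by (induction t) auto

lemma sat_cong:
  "(\<And>n. n \<in> free_vars \<phi> \<Longrightarrow> v n = w n) \<Longrightarrow> sat G v \<phi> \<longleftrightarrow> sat G w \<phi>"
proof (induction \<phi> arbitrary: v w)
  case (Eq s t)
  have "eval_term G v s = eval_term G w s" "eval_term G v t = eval_term G w t"
    by (rule eval_term_cong, rule Eq, simp)+
  then show ?case by simp
next
  case (Neg \<phi>)
  have "sat G v \<phi> \<longleftrightarrow> sat G w \<phi>"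
    by (rule Neg.IH, rule Neg.prems, simp)
  then show ?case by simp
next
  case (Conj \<phi> \<psi>)
  have "sat G v \<phi> \<longleftrightarrow> sat G w \<phi>"
    by (rule Conj.IH, rule Conj.prems, simp)
  moreover have "sat G v \<psi> \<longleftrightarrow> sat G w \<psi>"
    by (rule Conj.IH, rule Conj.prems, simp)
  ultimately show ?case by simp
next
  case (Ex n \<phi>)
  have "(v(n := a)) m = (w(n := a)) m" if "m \<in> free_vars \<phi>" for a m
    using Ex.prems[of m] that by (cases "m = n") simp_all
  then have "sat G (v(n := a)) \<phi> \<longleftrightarrow> sat G (w(n := a)) \<phi>" for a
    by (rule Ex.IH)
  then show ?case by simp
qed

lemma eval_term_hom:
  assumes "group G" "group H" "h \<in> hom G H" "v \<in> UNIV \<rightarrow> carrier G"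
  shows "eval_term H (h \<circ> v) t = h (eval_term G v t)"
proof -
  interpret group_hom G H h
    using assms(1-4) by (simp add: group_hom_def group_hom_axioms_def)
  show ?thesis
    by (induction t) (auto simp: eval_term_closed[OF assms(1,4)])
qed

lemma sat_iso:
  assumes "group G" "group H" "h \<in> iso G H" "v \<in> UNIV \<rightarrow> carrier G"
  shows "sat H (h \<circ> v) \<phi> \<longleftrightarrow> sat G v \<phi>"
  using assms(4)
proof (induction \<phi> arbitrary: v)
  case (Eq s t)
  have "h \<in> hom G H" "inj_on h (carrier G)"
    using assms(3) by (auto simp: iso_def bij_betw_def)
  then show ?case
    unfolding sat.simps using eval_term_hom[OF assms(1,2) _ Eq] eval_term_closed[OF assms(1) Eq]
    by (metis inj_on_eq_iff)
next
  case (Ex n \<phi>)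
  have *: "sat H ((h \<circ> v)(n := h a)) \<phi> \<longleftrightarrow> sat G (v(n := a)) \<phi>" if "a \<in> carrier G" for a
  proof -
    have "(h \<circ> v)(n := h a) = h \<circ> (v(n := a))" by auto
    moreover have "v(n := a) \<in> UNIV \<rightarrow> carrier G" using Ex.prems that by auto
    ultimately show ?thesis using Ex.IH[of "v(n := a)"] by (simp only:)
  qed
  have surj: "carrier H = h ` carrier G"
    using assms(3) by (auto simp: iso_def bij_betw_def)
  have "sat H (h \<circ> v) (group_formula.Ex n \<phi>) \<longleftrightarrow>
      (\<exists>a\<in>carrier G. sat H ((h \<circ> v)(n := h a)) \<phi>)"
    unfolding sat.simps surj bex_simps(7) ..
  also have "\<dots> \<longleftrightarrow> sat G v (group_formula.Ex n \<phi>)" using * by simp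
  finally show ?case .
qed auto

text \<open>
  Elementarity only tests finite parts of a map, so it suffices that each finite part comes from
  an automorphism; different parts may need different automorphisms.
\<close>

lemma partial_elementary_map_if_locally_automorphic:
  assumes G: "group G" and f: "f \<subseteq> carrier G \<times> carrier G"
    and ex: "\<And>s. finite s \<Longrightarrow> s \<subseteq> f \<Longrightarrow> \<exists>h\<in>iso G G. \<forall>(x, y)\<in>s. h x = y"
  shows "partial_elementary_map G f"
  unfolding partial_elementary_map_def
proof (intro conjI allI impI)
  show "single_valued f"
  proof (rule single_valuedI)
    fix x y z assume "(x, y) \<in> f" "(x, z) \<in> f"
    then show "y = z" using ex[of "{(x, y), (x, z)}"] by auto
  qed
next
  fix \<phi> v w
  assume v: "v \<in> UNIV \<rightarrow> carrier G" and vw: "\<forall>n\<in>free_vars \<phi>. (v n, w n) \<in> f"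
  have "\<exists>h\<in>iso G G. \<forall>(x, y)\<in>(\<lambda>n. (v n, w n)) ` free_vars \<phi>. h x = y"
    by (rule ex) (use vw finite_free_vars in auto)
  then obtain h where h: "h \<in> iso G G" "\<And>n. n \<in> free_vars \<phi> \<Longrightarrow> h (v n) = w n"
    by auto
  have "sat G w \<phi> \<longleftrightarrow> sat G (h \<circ> v) \<phi>"
    by (rule sat_cong) (simp add: h(2))
  then show "sat G v \<phi> \<longleftrightarrow> sat G w \<phi>"
    using sat_iso[OF G G h(1) v] by simp
qed (rule f)


section \<open>Transvections of a free group\<close>

lemma hom_eq_if_eq_on_generators:
  assumes "group G" "group H" "g \<in> hom G H" "h \<in> hom G H" "S \<subseteq> carrier G"
    and "\<And>x. x \<in> S \<Longrightarrow> g x = h x" and "x \<in> generate G S"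
  shows "g x = h x"
proof -
  interpret g: group_hom G H g
    using assms(1-4) by (simp add: group_hom_def group_hom_axioms_def)
  interpret h: group_hom G H h
    using assms(1-4) by (simp add: group_hom_def group_hom_axioms_def)
  show ?thesis
    using assms(7)
  proof (induction rule: generate.induct)
    case one
    show ?case by (simp only: g.hom_one h.hom_one)
  next
    case (incl x)
    then show ?case by (rule assms(6))
  next
    case (inv x)
    then have "x \<in> carrier G" using assms(5) by blast
    then show ?case by (simp only: g.hom_inv h.hom_inv assms(6)[OF inv])
  next
    case (eng x y)
    then have "x \<in> carrier G" "y \<in> carrier G"
      using group.generate_in_carrier[OF assms(1,5)] by blast+
    then show ?case by (simp only: g.hom_mult h.hom_mult eng.IH)
  qed
qed

lemma free_group_endomorphism_eq_id:
  assumes "h \<in> hom (free_group I) (free_group I)"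
    and "\<And>i. i \<in> I \<Longrightarrow> h (free_basis i) = free_basis i"
    and "x \<in> carrier (free_group I)"
  shows "h x = x"
proof -
  have "h x = id x"
  proof (rule hom_eq_if_eq_on_generators[where h = id and S = "free_basis ` I"])
    show "id \<in> hom (free_group I) (free_group I)" by (simp add: hom_def)
    show "x \<in> generate (free_group I) (free_basis ` I)"
      using assms(3) by (simp add: generate_free_basis)
  qed (use assms in \<open>auto simp: group_free_group free_basis_carrier\<close>)
  then show ?thesis by simp
qed

text \<open>The transvection with exponent \<open>-m\<close> is the inverse of the one with exponent \<open>m\<close>.\<close>

lemma transvection_automorphism:
  fixes m :: int
  assumes i: "i \<in> I" and j: "j \<in> I" and "i \<noteq> j"
  obtains h where "h \<in> iso (free_group I) (free_group I)"
    "h (free_basis i) = free_basis i \<otimes>\<^bsub>free_group I\<^esub> free_basis j [^]\<^bsub>free_group I\<^esub> m"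
    "\<And>l. l \<in> I \<Longrightarrow> l \<noteq> i \<Longrightarrow> h (free_basis l) = free_basis l"
proof -
  interpret F: group "free_group I" by (rule group_free_group)
  let ?F = "free_group I"
  define t where "t m = (\<lambda>l. if l = i then free_basis i \<otimes>\<^bsub>?F\<^esub> free_basis j [^]\<^bsub>?F\<^esub> m
      else free_basis l)" for m :: int
  have bc: "free_basis l \<in> carrier ?F" if "l \<in> I" for l
    using that by (simp add: free_basis_carrier)
  have "\<exists>h\<in>hom ?F ?F. \<forall>l\<in>I. h (free_basis l) = t m l" for m
    by (rule free_group_extend[OF group_free_group]) (use i j bc in \<open>auto simp: t_def\<close>)
  then obtain h where h: "\<And>m. h m \<in> hom ?F ?F" "\<And>m l. l \<in> I \<Longrightarrow> h m (free_basis l) = t m l"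
    by metis
  have inverse: "h m (h (- m) x) = x" if x: "x \<in> carrier ?F" for m x
  proof -
    interpret h: group_hom ?F ?F "h m"
      using h(1) by (simp add: group_hom_def group_hom_axioms_def group_free_group)
    have "(h m \<circ> h (- m)) x = x"
    proof (rule free_group_endomorphism_eq_id[OF hom_compose[OF h(1) h(1)] _ x])
      fix l assume l: "l \<in> I"
      show "(h m \<circ> h (- m)) (free_basis l) = free_basis l"
      proof (cases "l = i")
        case True
        have "h m (h (- m) (free_basis i)) =
            h m (free_basis i) \<otimes>\<^bsub>?F\<^esub> h m (free_basis j) [^]\<^bsub>?F\<^esub> (- m)"
          using i j bc by (simp add: h(2) t_def[of "- m"] h.hom_int_pow)
        also have "\<dots> = free_basis i \<otimes>\<^bsub>?F\<^esub>
            (free_basis j [^]\<^bsub>?F\<^esub> m \<otimes>\<^bsub>?F\<^esub> free_basis j [^]\<^bsub>?F\<^esub> (- m))"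
          using i j \<open>i \<noteq> j\<close> bc by (simp add: h(2) t_def F.m_assoc)
        also have "\<dots> = free_basis i"
          using i j bc by (simp add: F.int_pow_neg)
        finally show ?thesis using True by simp
      qed (use l h(2) in \<open>simp add: t_def\<close>)
    qed
    then show ?thesis by simp
  qed
  have "bij_betw (h m) (carrier ?F) (carrier ?F)"
  proof (rule bij_betw_byWitness[where f' = "h (- m)"])
    show "\<forall>x\<in>carrier ?F. h (- m) (h m x) = x" using inverse[of _ "- m"] by simp
  qed (use inverse[of _ m] h(1) in \<open>auto simp: hom_def\<close>)
  then have "h m \<in> iso ?F ?F" using h(1) by (simp add: iso_def)
  then show thesis
    by (rule that) (use i h(2) in \<open>auto simp: t_def\<close>)
qed


section \<open>The sequence with infinitely divisible tails\<close>

text \<open>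
  The exponent is chosen so that \<open>e\<^sub>n = d\<^sub>n e\<^sub>n\<^sub>+\<^sub>1\<^sup>2\<close>: modulo the \<open>d\<^sub>n\<close>, each basis element becomes the
  square of the next one.
\<close>

definition telescope :: "'i set \<Rightarrow> (nat \<Rightarrow> 'i) \<Rightarrow> nat \<Rightarrow> 'i letter list" where
  "telescope I \<iota> n = free_basis (\<iota> n) \<otimes>\<^bsub>free_group I\<^esub>
     free_basis (\<iota> (Suc n)) [^]\<^bsub>free_group I\<^esub> (- 2 :: int)"

lemma telescope_closed:
  assumes "range \<iota> \<subseteq> I"
  shows "telescope I \<iota> n \<in> carrier (free_group I)"
proof -
  interpret F: group "free_group I" by (rule group_free_group)
  have "free_basis (\<iota> n) \<in> carrier (free_group I)" for n
    using assms by (auto simp: free_basis_carrier)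
  then show ?thesis by (simp add: telescope_def)
qed

lemma telescope_mult_square:
  assumes "range \<iota> \<subseteq> I"
  shows "telescope I \<iota> n \<otimes>\<^bsub>free_group I\<^esub>
    (free_basis (\<iota> (Suc n)) \<otimes>\<^bsub>free_group I\<^esub> free_basis (\<iota> (Suc n))) = free_basis (\<iota> n)"
proof -
  interpret F: group "free_group I" by (rule group_free_group)
  let ?F = "free_group I" and ?e = "\<lambda>n. free_basis (\<iota> n)"
  have c: "?e n \<in> carrier ?F" for n
    using assms by (auto simp: free_basis_carrier)
  have "?e (Suc n) \<otimes>\<^bsub>?F\<^esub> ?e (Suc n) = ?e (Suc n) [^]\<^bsub>?F\<^esub> (2 :: int)"
    using F.int_pow_mult[OF c, of "Suc n" 1 1] c by simp
  then show ?thesis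
    using c by (simp add: telescope_def F.m_assoc F.int_pow_mult[symmetric])
qed

text \<open>
  The transvections \<open>e\<^sub>n \<mapsto> e\<^sub>n e\<^sub>n\<^sub>+\<^sub>1\<^sup>2\<close> are composed in the order of increasing \<open>n\<close>: each of them fixes
  the basis elements already reached, and the earlier ones have not yet moved \<open>d\<^sub>n\<close>.
\<close>

lemma straightening_automorphism:
  assumes "inj \<iota>" and I: "range \<iota> \<subseteq> I"
  shows "\<exists>h\<in>iso (free_group I) (free_group I).
    (\<forall>i<n. h (telescope I \<iota> i) = free_basis (\<iota> i)) \<and>
    (\<forall>i\<ge>n. h (free_basis (\<iota> i)) = free_basis (\<iota> i))"
proof (induction n)
  case 0
  have "id \<in> iso (free_group I) (free_group I)" by (simp add: iso_def hom_def)
  then show ?case by (intro bexI[of _ id]) auto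
next
  case (Suc n)
  interpret F: group "free_group I" by (rule group_free_group)
  let ?F = "free_group I" and ?e = "\<lambda>n. free_basis (\<iota> n)"
  have c: "?e n \<in> carrier ?F" for n
    using I by (auto simp: free_basis_carrier)
  obtain h where h: "h \<in> iso ?F ?F" "\<And>i. i < n \<Longrightarrow> h (telescope I \<iota> i) = ?e i"
    "\<And>i. i \<ge> n \<Longrightarrow> h (?e i) = ?e i"
    using Suc by blast
  have ne: "\<iota> n \<noteq> \<iota> (Suc n)" using \<open>inj \<iota>\<close> by (simp add: inj_eq)
  obtain t where t: "t \<in> iso ?F ?F"
    "t (?e n) = ?e n \<otimes>\<^bsub>?F\<^esub> ?e (Suc n) [^]\<^bsub>?F\<^esub> (2 :: int)"
    "\<And>l. l \<in> I \<Longrightarrow> l \<noteq> \<iota> n \<Longrightarrow> t (free_basis l) = free_basis l"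
    using transvection_automorphism[OF _ _ ne, of I 2] I by blast
  have t_fix: "t (?e i) = ?e i" if "i \<noteq> n" for i
    using t(3)[of "\<iota> i"] I that \<open>inj \<iota>\<close> by (auto simp: inj_eq)
  interpret h: group_hom ?F ?F h
    using h(1) by (simp add: iso_def group_hom_def group_hom_axioms_def group_free_group)
  interpret t: group_hom ?F ?F t
    using t(1) by (simp add: iso_def group_hom_def group_hom_axioms_def group_free_group)
  have "h (telescope I \<iota> n) = telescope I \<iota> n"
    using c by (simp add: telescope_def h.hom_int_pow h(3))
  moreover have "t (telescope I \<iota> n) = ?e n"
    using c by (simp add: telescope_def t.hom_int_pow t_fix t(2) F.m_assoc
        F.int_pow_mult[symmetric])
  ultimately have "\<forall>i<Suc n. (t \<circ> h) (telescope I \<iota> i) = ?e i"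
    using h(2) t_fix by (auto simp: less_Suc_eq)
  moreover have "\<forall>i\<ge>Suc n. (t \<circ> h) (?e i) = ?e i"
    using h(3) t_fix by simp
  ultimately show ?case
    using iso_set_trans[OF h(1) t(1)] by (metis o_def)
qed

lemma partial_elementary_map_telescope:
  assumes "inj \<iota>" and "range \<iota> \<subseteq> I"
  shows "partial_elementary_map (free_group I)
    (range (\<lambda>n. (telescope I \<iota> n, free_basis (\<iota> n))))" (is "partial_elementary_map _ (range ?p)")
proof (rule partial_elementary_map_if_locally_automorphic[OF group_free_group])
  show "range ?p \<subseteq> carrier (free_group I) \<times> carrier (free_group I)"
    using assms(2) by (auto simp: telescope_closed free_basis_carrier)
next
  fix s assume "finite s" "s \<subseteq> range ?p"
  then obtain N where N: "finite N" "s = ?p ` N"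
    by (meson finite_subset_image)
  then obtain n where n: "\<forall>i\<in>N. i < n"
    using finite_nat_set_iff_bounded by blast
  obtain h where "h \<in> iso (free_group I) (free_group I)"
    "\<forall>i<n. h (telescope I \<iota> i) = free_basis (\<iota> i)"
    using straightening_automorphism[OF assms, of n] by blast
  then show "\<exists>h\<in>iso (free_group I) (free_group I). \<forall>(x, y)\<in>s. h x = y"
    using n N(2) by (intro bexI[of _ h]) auto
qed


section \<open>Exponent sums\<close>

definition exponent_sum :: "'i \<Rightarrow> 'i letter list \<Rightarrow> int" where
  "exponent_sum i w = int (count_list w (i, True)) - int (count_list w (i, False))"

lemma exponent_sum_Cons: "exponent_sum i (x # w) = exponent_sum i [x] + exponent_sum i w"
  by (simp add: exponent_sum_def)

lemma exponent_sum_inv_letter: "exponent_sum i [inv_letter x] = - exponent_sum i [x]"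
  by (cases x) (auto simp: exponent_sum_def inv_letter_def)

lemma exponent_sum_push: "exponent_sum i (push_letter x w) = exponent_sum i [x] + exponent_sum i w"
proof (cases w)
  case (Cons y v)
  then show ?thesis
    using exponent_sum_Cons[of i y v] exponent_sum_Cons[of i x w]
    by (auto simp: exponent_sum_inv_letter)
qed (simp add: exponent_sum_def)

lemma exponent_sum_mult:
  assumes "v \<in> carrier (free_group I)"
  shows "exponent_sum i (u \<otimes>\<^bsub>free_group I\<^esub> v) = exponent_sum i u + exponent_sum i v"
proof -
  have "exponent_sum i (foldr push_letter u v) = exponent_sum i u + exponent_sum i v"
  proof (induction u)
    case (Cons x u)
    then show ?case using exponent_sum_Cons[of i x u] by (simp add: exponent_sum_push)
  qed (simp add: exponent_sum_def)
  then show ?thesis using assms by (simp add: mult_free_group carrier_free_group)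
qed

lemma exponent_sum_free_basis: "exponent_sum i (free_basis j) = (if i = j then 1 else 0)"
  by (simp add: exponent_sum_def free_basis_def)

lemma exponent_sum_eq_0: "i \<notin> fst ` set w \<Longrightarrow> exponent_sum i w = 0"
  by (metis count_notin diff_self exponent_sum_def fst_conv image_eqI)


section \<open>Nested squares\<close>

text \<open>
  The term \<open>x\<^sub>0 (x\<^sub>1 (\<dots> (x\<^sub>n\<^sub>-\<^sub>1 t\<^sup>2)\<^sup>2 \<dots>)\<^sup>2)\<^sup>2\<close>, where \<open>x\<^sub>i\<close> is variable \<open>i + 2\<close>; variables \<open>0\<close> and \<open>1\<close>
  are kept for the value of the term and for the innermost square root. The innermost factor is added
  first, so that the recursion runs along \<open>e\<^sub>n = d\<^sub>n e\<^sub>n\<^sub>+\<^sub>1\<^sup>2\<close>.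
\<close>

primrec nested_squares :: "nat \<Rightarrow> group_term \<Rightarrow> group_term" where
  "nested_squares 0 t = t"
| "nested_squares (Suc n) t = nested_squares n (Mult (Var (n + 2)) (Mult t t))"

lemma eval_nested_squares_telescope:
  assumes "range \<iota> \<subseteq> I" "\<And>i. i < n \<Longrightarrow> v (i + 2) = telescope I \<iota> i"
    and "eval_term (free_group I) v t = free_basis (\<iota> n)"
  shows "eval_term (free_group I) v (nested_squares n t) = free_basis (\<iota> 0)"
  using assms(2,3)
  by (induction n arbitrary: t) (use telescope_mult_square[OF assms(1)] in simp_all)

lemma exponent_sum_nested_squares:
  assumes v: "v \<in> UNIV \<rightarrow> carrier (free_group I)"
    and "\<And>j. j < n \<Longrightarrow> exponent_sum i (v (j + 2)) = 0"
  shows "exponent_sum i (eval_term (free_group I) v (nested_squares n t)) =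
    2 ^ n * exponent_sum i (eval_term (free_group I) v t)"
  using assms(2)
proof (induction n arbitrary: t)
  case (Suc n)
  interpret F: group "free_group I" by (rule group_free_group)
  have "eval_term (free_group I) v t \<in> carrier (free_group I)"
    by (rule eval_term_closed[OF group_free_group v])
  moreover have "exponent_sum i (eval_term (free_group I) v (nested_squares (Suc n) t)) =
      2 ^ n * exponent_sum i (eval_term (free_group I) v (Mult (Var (n + 2)) (Mult t t)))"
    unfolding nested_squares.simps by (rule Suc.IH) (use Suc.prems in auto)
  ultimately show ?case using Suc.prems[of n] by (simp add: exponent_sum_mult)
qed simp


section \<open>Failure of homogeneity\<close>

lemma not_aleph1_homogeneous_free_group:
  assumes "infinite I"
  shows "\<not> aleph1_homogeneous (free_group I)"
proof
  assume hom: "aleph1_homogeneous (free_group I)"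
  interpret F: group "free_group I" by (rule group_free_group)
  let ?F = "free_group I"
  obtain \<iota> :: "nat \<Rightarrow> 'a" where \<iota>: "inj \<iota>" "range \<iota> \<subseteq> I"
    using infinite_countable_subset[OF assms] by blast
  let ?e = "\<lambda>n. free_basis (\<iota> n)" and ?d = "telescope I \<iota>"
  let ?f = "range (\<lambda>n. (?d n, ?e n))"
  have e: "?e n \<in> carrier ?F" for n
    using \<iota>(2) by (auto simp: free_basis_carrier)
  have d: "?d n \<in> carrier ?F" for n
    using telescope_closed[OF \<iota>(2)] .
  have "\<exists>b\<in>carrier ?F. partial_elementary_map ?F (?f \<union> {(?e 0, b)})"
  proof (rule hom[unfolded aleph1_homogeneous_def, rule_format])
    show "Domain ?f \<subseteq> carrier ?F" using d by auto
    show "countable (Domain ?f)" unfolding Domain_fst by (intro countable_image) simp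
  qed (use partial_elementary_map_telescope[OF \<iota>] e in simp_all)
  then obtain b where b: "b \<in> carrier ?F" "partial_elementary_map ?F (?f \<union> {(?e 0, b)})"
    by blast
  have "\<not> range \<iota> \<subseteq> fst ` set b"
    using range_inj_infinite[OF \<iota>(1)] finite_subset by blast
  then obtain k where k: "\<iota> k \<notin> fst ` set b" by blast
  define \<phi> where "\<phi> = Ex 1 (Eq (Var 0) (nested_squares (Suc k) (Var 1)))"
  \<comment> \<open>Variable 1 is bound in \<open>\<phi>\<close>; its values here are arbitrary.\<close>
  define v where "v n = (if n < 2 then ?e 0 else ?d (n - 2))" for n
  define w where "w n = (if n < 2 then b else ?e (n - 2))" for n
  have v: "v \<in> UNIV \<rightarrow> carrier ?F" using e d by (auto simp: v_def)
  have w: "w \<in> UNIV \<rightarrow> carrier ?F" using e b(1) by (auto simp: w_def)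
  have "free_vars \<phi> \<subseteq> - {1}"
    by (auto simp: \<phi>_def)
  then have "\<forall>n\<in>free_vars \<phi>. (v n, w n) \<in> ?f \<union> {(?e 0, b)}"
    by (auto simp: v_def w_def less_2_cases_iff)
  then have "sat ?F v \<phi> \<longleftrightarrow> sat ?F w \<phi>"
    using b(2) v w unfolding partial_elementary_map_def by blast
  moreover have "sat ?F v \<phi>"
  proof -
    have "eval_term ?F (v(1 := ?e (Suc k))) (nested_squares (Suc k) (Var 1)) = ?e 0"
      by (rule eval_nested_squares_telescope[OF \<iota>(2)]) (auto simp: v_def)
    then show ?thesis
      unfolding \<phi>_def sat.simps using e[of "Suc k"]
      by (intro bexI[of _ "?e (Suc k)"]) (auto simp: v_def)
  qed
  ultimately obtain y where y: "y \<in> carrier ?F"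
    "b = eval_term ?F (w(1 := y)) (nested_squares (Suc k) (Var 1))"
    unfolding \<phi>_def sat.simps by (auto simp: w_def)
  have "w(1 := y) \<in> UNIV \<rightarrow> carrier ?F" using w y(1) by auto
  \<comment> \<open>Besides \<open>y\<close>, only the innermost factor contributes to the exponent of the \<open>k\<close>-th basis
     element, so that layer is treated separately.\<close>
  then have "exponent_sum (\<iota> k) b =
      2 ^ k * exponent_sum (\<iota> k)
        (eval_term ?F (w(1 := y)) (Mult (Var (k + 2)) (Mult (Var 1) (Var 1))))"
    unfolding y(2) nested_squares.simps
    by (rule exponent_sum_nested_squares)
      (use \<iota>(1) in \<open>auto simp: w_def exponent_sum_free_basis inj_eq\<close>)
  also have "\<dots> = 2 ^ k * (1 + 2 * exponent_sum (\<iota> k) y)"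
    using y(1) by (simp add: w_def exponent_sum_mult exponent_sum_free_basis)
  finally have "1 + 2 * exponent_sum (\<iota> k) y = 0"
    using exponent_sum_eq_0[OF k] by simp
  then show False by presburger
qed

theorem proposition3p8:
  fixes \<kappa> :: "'i rel"
  assumes "Card_order \<kappa>"
    and "natLeq <o \<kappa>"
  shows "\<not> aleph1_homogeneous (free_group (Field \<kappa>))"
proof (rule not_aleph1_homogeneous_free_group)
  have "natLeq \<le>o |Field \<kappa>|"
    using ordLeq_ordIso_trans[OF ordLess_imp_ordLeq[OF assms(2)]
        ordIso_symmetric[OF card_of_Field_ordIso[OF assms(1)]]] .
  then show "infinite (Field \<kappa>)"
    using infinite_iff_natLeq_ordLeq by blast
qed

end
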